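(* Let $k \geq 1$ and let $\lambda$ be a number with $q_k(\lambda) = 0$. Then for all integers $a \geq 1$ and $0 \leq b \leq k$, $$q_{a(k+1) + b}(\lambda) = \left(q_{k+1}(\lambda)\right)^a q_b(\lambda).$$
   Context: The path $P_n$ is the graph with vertex set $[n]=\{1,\dots,n\}$ and edges $\{i,i+1\}$ for $i \in [n-1]$. For $n \ge 1$, $q_n(x)=\det(\mathbf{A}(P_n)-x\mathbf{I}_n)$, where $\mathbf{A}(P_n)$ is the adjacency matrix of $P_n$; by convention $q_0(x)=1$. *)

theory Defs
  imports Complex_Main "Jordan_Normal_Form.Determinant"
begin

(* The path on the vertex set {1..n}. *)
definition path_edges :: "nat \<Rightarrow> nat set set" where
  "path_edges n = {{i, i + 1} | i. 1 \<le> i \<and> i + 1 \<le> n}"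

(* Adjacency matrix of the graph with vertex set {1..n} and edge set E. Matrix indices start
   at 0, so index i stands for vertex i + 1. *)
definition adj_mat :: "nat \<Rightarrow> nat set set \<Rightarrow> 'a :: comm_ring_1 mat" where
  "adj_mat n E = mat n n (\<lambda>(i, j). if {i + 1, j + 1} \<in> E then 1 else 0)"

definition q :: "nat \<Rightarrow> 'a :: comm_ring_1 \<Rightarrow> 'a" where
  "q n x = (if n = 0 then 1 else det (adj_mat n (path_edges n) - x \<cdot>\<^sub>m 1\<^sub>m n))"

end

theory Submission
  imports Defs
begin

text \<open>
  Expanding the determinant along its last row gives the three-term recurrence
  \<open>q (n + 2) = - x * q (n + 1) - q n\<close>. If \<open>q k\<close> vanishes at \<open>\<mu>\<close>, the sequences
  \<open>n \<mapsto> q (k + 1 + n)\<close> and \<open>n \<mapsto> q (k + 1) * q n\<close> satisfy the same recurrence at \<open>\<mu>\<close>,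
  and both are preceded at \<open>n = -1\<close> by the value 0, so they coincide: advancing the index by
  \<open>k + 1\<close> multiplies by \<open>q (k + 1)\<close>.
\<close>

text \<open>With the entries given by index arithmetic instead of edge sets, minors can be compared
  entry by entry. At size 0 the determinant is 1, in line with the convention for
  \<open>q 0\<close>.\<close>

definition path_mat :: "nat \<Rightarrow> 'a :: comm_ring_1 \<Rightarrow> 'a mat" where
  "path_mat n x = mat n n (\<lambda>(i, j). if i = j then - x else if j = i + 1 \<or> i = j + 1 then 1 else 0)"

lemma path_edges_iff:
  assumes "i < n" "j < n"
  shows "{i + 1, j + 1} \<in> path_edges n \<longleftrightarrow> j = i + 1 \<or> i = j + 1"
  using assms by (auto simp: path_edges_def doubleton_eq_iff)

lemma q_eq_det_path_mat: "q n x = det (path_mat n x)"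
proof (cases "n = 0")
  case True
  then show ?thesis by (simp add: q_def path_mat_def)
next
  case False
  have "adj_mat n (path_edges n) - x \<cdot>\<^sub>m 1\<^sub>m n = path_mat n x"
  proof (rule eq_matI)
    fix i j assume "i < dim_row (path_mat n x)" "j < dim_col (path_mat n x)"
    then have "i < n" "j < n" by (simp_all add: path_mat_def)
    then show "(adj_mat n (path_edges n) - x \<cdot>\<^sub>m 1\<^sub>m n) $$ (i, j) = path_mat n x $$ (i, j)"
      using path_edges_iff[of i n j] by (simp add: adj_mat_def path_mat_def)
  qed (simp_all add: adj_mat_def path_mat_def)
  with False show ?thesis by (simp add: q_def)
qed

lemma q_0 [simp]: "q 0 x = 1"
  by (simp add: q_def)

lemma q_Suc_0: "q (Suc 0) x = - x"
  by (simp add: q_eq_det_path_mat path_mat_def det_single)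

lemma q_Suc_Suc: "q (Suc (Suc n)) x = - x * q (Suc n) x - q n x"
proof -
  let ?M = "path_mat (Suc (Suc n)) x"
  let ?B = "mat_delete ?M (Suc n) n"
  have M: "?M \<in> carrier_mat (Suc (Suc n)) (Suc (Suc n))"
    by (simp add: path_mat_def)
  have B: "?B \<in> carrier_mat (Suc n) (Suc n)"
    using mat_delete_carrier[OF M] by simp
  have M_del: "mat_delete ?M (Suc n) (Suc n) = path_mat (Suc n) x"
    by (rule eq_matI) (auto simp: mat_delete_def path_mat_def)
  have B_del: "mat_delete ?B n n = path_mat n x"
    by (rule eq_matI) (auto simp: mat_delete_def path_mat_def)
  have "det ?B = (\<Sum>i<Suc n. ?B $$ (i, n) * cofactor ?B i n)"
    by (rule laplace_expansion_column[OF B]) simp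
  \<comment> \<open>The last column of \<open>?B\<close> is the last column of \<open>?M\<close>
    without its bottom entry; all that survives there is the 1 in row \<open>n\<close>.\<close>
  also have "\<dots> = ?B $$ (n, n) * cofactor ?B n n"
    by (simp add: mat_delete_def path_mat_def)
  also have "\<dots> = det (path_mat n x)"
    by (simp add: cofactor_def B_del) (simp add: mat_delete_def path_mat_def)
  finally have det_B: "det ?B = det (path_mat n x)" .
  have "det ?M = (\<Sum>j<Suc (Suc n). ?M $$ (Suc n, j) * cofactor ?M (Suc n) j)"
    by (rule laplace_expansion_row[OF M]) simp
  also have "\<dots> = cofactor ?M (Suc n) n - x * cofactor ?M (Suc n) (Suc n)"
    by (simp add: path_mat_def)
  \<comment> \<open>The off-diagonal cofactor has sign (-1)^(2n + 1) = -1, whence the minus before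
    the second determinant.\<close>
  also have "\<dots> = - x * det (path_mat (Suc n) x) - det (path_mat n x)"
    by (simp add: cofactor_def M_del det_B)
  finally show ?thesis by (simp add: q_eq_det_path_mat)
qed

lemma q_shift:
  assumes "q k x = 0"
  shows "q (k + 1 + n) x = q (k + 1) x * q n x"
proof (induction n rule: induct_nat_012)
  case 1
  \<comment> \<open>Here the root enters: \<open>q k x = 0\<close> removes the last term of
    \<open>q (k + 2) x = - x * q (k + 1) x - q k x\<close>.\<close>
  then show ?case using assms by (simp add: q_Suc_Suc q_Suc_0)
next
  case (ge2 n)
  then show ?case by (simp add: q_Suc_Suc algebra_simps)
qed simp

lemma q_shift_mult:
  assumes "q k x = 0"
  shows "q (a * (k + 1) + b) x = q (k + 1) x ^ a * q b x"
proof (induction a)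
  case (Suc a)
  have "q (Suc a * (k + 1) + b) x = q (k + 1 + (a * (k + 1) + b)) x"
    by (simp add: algebra_simps)
  also have "\<dots> = q (k + 1) x ^ Suc a * q b x"
    unfolding q_shift[OF assms] Suc.IH by (simp add: mult.assoc)
  finally show ?case .
qed simp

theorem theorem4:
  fixes k a b :: nat and \<mu> :: complex
  assumes "k \<ge> 1"
    and "q k \<mu> = 0"
    and "a \<ge> 1"
    and "b \<le> k"
  shows "q (a * (k + 1) + b) \<mu> = q (k + 1) \<mu> ^ a * q b \<mu>"
  using assms(2) by (rule q_shift_mult)

end
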